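(* Let $U\in(0,1)$, $\alpha\in\mathbb{R}$, $\ell>0$, $V=-U\ln U$ and $\gamma=\alpha-\ln U$. Let $(u,v,\varphi)$, with $u=u(t,x,y)$, $v=v(t,x,y)$, $\varphi=\varphi(t,y)$, be a sufficiently smooth solution, $\ell$-periodic in $y$, of the system $$\begin{cases} Uu_x-\Delta u=Ue^{Ux}\big(U(\varphi_y)^2-\varphi_{yy}\big), & x<0,\\ Vu_x-\Delta(v-\alpha u)+Uv_x=U\varphi_te^{Ux}+(\alpha-\ln U)U^2(1+Ux)e^{Ux}(\varphi_y)^2-U^2(\alpha-\ln U)xe^{Ux}\varphi_{yy}, & x<0,\\ Uv_x-\Delta v=0, & x>0,\\ u(0)=[v]=0,\\ Uv(0)-u_x(0)=\tfrac12U(\varphi_y)^2,\\ [v_x]=-\alpha u_x(0), \end{cases}$$ such that the functions $(x,y)\mapsto e^{-Ux/2}u(t,x,y)$ and $(x,y)\mapsto e^{-Ux/2}v(t,x,y)$ are bounded in $(-\infty,0]\times[-\ell/2,\ell/2]$ and in $\mathbb{R}\times[-\ell/2,\ell/2]$, respectively. Then the interface $\varphi$ solves, for any $k\ge0$, $$X_kU\,\widehat{\varphi}_t(t,k)=\big(-4\lambda_k^2+(\gamma-1)U^2\lambda_k\big)\widehat\varphi(t,k)+\tfrac14\big(X_k^3-3UX_k^2-4\gamma U^2X_k+4\gamma U^3\big)\widehat{(\varphi_y)^2}(t,k),$$ where $X_k=\sqrt{U^2+4\lambda_k}$.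
   Context: The spatial domain is the strip $\mathbb{R}\times[-\ell/2,\ell/2]$ with periodicity in $y$; $\Delta=D_{xx}+D_{yy}$. The function $u$ is set equal to $0$ for $x\ge0$, and $u(0)$, $u_x(0)$ denote the traces from the left, $u(0^-)$, $u_x(0^-)$. The bracket $[w]=w(0^+)-w(0^-)$ denotes the jump across $x=0$, and $v(0)$ is the common value at $x=0$. Let $\{w_k\}_{k\ge0}$ be a complete orthonormal set of ($\ell$-periodic) eigenfunctions in $L^2(-\ell/2,\ell/2)$ of $D_{yy}$ with periodic boundary conditions, with eigenvalues $-\lambda_k$, where $\lambda_0=0$ and $\lambda_{2j-1}=\lambda_{2j}=4\pi^2j^2/\ell^2$ for $j\ge1$. $\widehat f(k)$ denotes the $k$-th coefficient of $f=\sum_k\widehat f(k)w_k$; for functions depending also on $t$ (or $x$), the coefficients are taken with respect to $y$. *)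

theory Defs
  imports "HOL-Analysis.Analysis"
begin

text \<open>Partial derivatives in the first and second argument: \<open>D1\<close> is \<open>D\<^sub>x\<close> for functions of
  \<open>(x, y)\<close>, and \<open>D2\<close> is \<open>D\<^sub>y\<close> for functions of \<open>(x, y)\<close> or \<open>(t, y)\<close>.\<close>

definition D1 :: "(real \<Rightarrow> real \<Rightarrow> real) \<Rightarrow> real \<Rightarrow> real \<Rightarrow> real" where
  "D1 f a b = deriv (\<lambda>s. f s b) a"

definition D2 :: "(real \<Rightarrow> real \<Rightarrow> real) \<Rightarrow> real \<Rightarrow> real \<Rightarrow> real" where
  "D2 f a b = deriv (f a) b"

definition Lap :: "(real \<Rightarrow> real \<Rightarrow> real) \<Rightarrow> real \<Rightarrow> real \<Rightarrow> real" where
  "Lap f x y = D1 (D1 f) x y + D2 (D2 f) x y"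

text \<open>Time derivative relative to the time interval \<^term>\<open>J\<close>; one-sided at end points
  belonging to \<^term>\<open>J\<close>.\<close>

definition Dt :: "real set \<Rightarrow> (real \<Rightarrow> real \<Rightarrow> real) \<Rightarrow> real \<Rightarrow> real \<Rightarrow> real" where
  "Dt J f t y = vector_derivative (\<lambda>s. f s y) (at t within J)"

text \<open>\<^term>\<open>C_diff k S f\<close>: \<^term>\<open>f\<close> is of class \<open>C\<^sup>k\<close> on the open set \<^term>\<open>S\<close>.\<close>

primrec C_diff :: "nat \<Rightarrow> (real \<times> real) set \<Rightarrow> (real \<Rightarrow> real \<Rightarrow> real) \<Rightarrow> bool" where
  "C_diff 0 S f \<longleftrightarrow> continuous_on S (\<lambda>(x, y). f x y)"
| "C_diff (Suc k) S f \<longleftrightarrow>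
     continuous_on S (\<lambda>(x, y). f x y) \<and>
     (\<forall>(x, y) \<in> S. (\<lambda>s. f s y) differentiable (at x) \<and> f x differentiable (at y)) \<and>
     C_diff k S (D1 f) \<and> C_diff k S (D2 f)"

definition extends_continuously :: "(real \<times> real) set \<Rightarrow> (real \<Rightarrow> real \<Rightarrow> real) \<Rightarrow> bool" where
  "extends_continuously S f \<longleftrightarrow>
     (\<exists>g. continuous_on (closure S) g \<and> (\<forall>(x, y) \<in> S. g (x, y) = f x y))"

text \<open>Classical regularity for a second order problem with first order conditions on the
  boundary: \<open>C\<^sup>2\<close> in the open set \<^term>\<open>S\<close>, \<open>C\<^sup>1\<close> up to its boundary.\<close>

definition classical_on :: "(real \<times> real) set \<Rightarrow> (real \<Rightarrow> real \<Rightarrow> real) \<Rightarrow> bool" where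
  "classical_on S f \<longleftrightarrow> C_diff 2 S f \<and> extends_continuously S f \<and>
     extends_continuously S (D1 f) \<and> extends_continuously S (D2 f)"

definition regular_interface :: "real set \<Rightarrow> (real \<Rightarrow> real \<Rightarrow> real) \<Rightarrow> bool" where
  "regular_interface J \<phi> \<longleftrightarrow>
     (\<forall>t\<in>J. \<forall>y. (\<lambda>s. \<phi> s y) differentiable (at t within J) \<and>
        \<phi> t differentiable (at y) \<and> D2 \<phi> t differentiable (at y)) \<and>
     continuous_on (J \<times> UNIV) (\<lambda>(t, y). \<phi> t y) \<and>
     continuous_on (J \<times> UNIV) (\<lambda>(t, y). Dt J \<phi> t y) \<and>
     continuous_on (J \<times> UNIV) (\<lambda>(t, y). D2 \<phi> t y) \<and>
     continuous_on (J \<times> UNIV) (\<lambda>(t, y). D2 (D2 \<phi>) t y)"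

text \<open>Traces at \<open>x = 0\<^sup>-\<close> and \<open>x = 0\<^sup>+\<close>, and the jump \<open>[f] = f(0\<^sup>+) - f(0\<^sup>-)\<close>. They are only used
  for functions for which \<^const>\<open>extends_continuously\<close> guarantees that the limits exist.\<close>

definition trace_left :: "(real \<Rightarrow> real \<Rightarrow> real) \<Rightarrow> real \<Rightarrow> real" where
  "trace_left f y = Lim (at_left 0) (\<lambda>x. f x y)"

definition trace_right :: "(real \<Rightarrow> real \<Rightarrow> real) \<Rightarrow> real \<Rightarrow> real" where
  "trace_right f y = Lim (at_right 0) (\<lambda>x. f x y)"

definition jump :: "(real \<Rightarrow> real \<Rightarrow> real) \<Rightarrow> real \<Rightarrow> real" where
  "jump f y = trace_right f y - trace_left f y"

definition lam :: "real \<Rightarrow> nat \<Rightarrow> real" where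
  "lam L k = 4 * pi\<^sup>2 * (real ((k + 1) div 2))\<^sup>2 / L\<^sup>2"

lemma lam_values:
  "lam L 0 = 0"
  "j \<ge> 1 \<Longrightarrow> lam L (2 * j - 1) = 4 * pi\<^sup>2 * (real j)\<^sup>2 / L\<^sup>2"
  "j \<ge> 1 \<Longrightarrow> lam L (2 * j) = 4 * pi\<^sup>2 * (real j)\<^sup>2 / L\<^sup>2"
  by (auto simp: lam_def)

definition X :: "real \<Rightarrow> real \<Rightarrow> nat \<Rightarrow> real" where
  "X U L k = sqrt (U\<^sup>2 + 4 * lam L k)"

definition fcoef :: "real \<Rightarrow> (nat \<Rightarrow> real \<Rightarrow> complex) \<Rightarrow> (real \<Rightarrow> complex) \<Rightarrow> nat \<Rightarrow> complex" where
  "fcoef L w f k = (LINT y:{- L/2..L/2}|lborel. f y * cnj (w k y))"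

text \<open>The eigenfunctions are allowed to be complex-valued, so that both the trigonometric system
  and the complex exponentials are covered.\<close>

definition complete_system :: "real \<Rightarrow> (nat \<Rightarrow> real \<Rightarrow> complex) \<Rightarrow> bool" where
  "complete_system L w \<longleftrightarrow>
     (\<forall>f \<in> borel_measurable borel.
        set_integrable lborel {- L/2..L/2} (\<lambda>y. (cmod (f y))\<^sup>2) \<longrightarrow>
        (\<lambda>n. LINT y:{- L/2..L/2}|lborel. (cmod (f y - (\<Sum>k<n. fcoef L w f k * w k y)))\<^sup>2)
          \<longlonglongrightarrow> 0)"

definition eigenbasis :: "real \<Rightarrow> (nat \<Rightarrow> real \<Rightarrow> complex) \<Rightarrow> bool" where
  "eigenbasis L w \<longleftrightarrow>
     (\<forall>k y. w k (y + L) = w k y) \<and>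
     (\<forall>k. \<exists>w'. \<forall>y. (w k has_vector_derivative w' y) (at y) \<and>
        (w' has_vector_derivative (- lam L k *\<^sub>R w k y)) (at y)) \<and>
     (\<forall>j k. fcoef L w (w j) k = (if j = k then 1 else 0)) \<and>
     complete_system L w"

abbreviation hat :: "real \<Rightarrow> (nat \<Rightarrow> real \<Rightarrow> complex) \<Rightarrow> (real \<Rightarrow> real) \<Rightarrow> nat \<Rightarrow> complex" where
  "hat L w f k \<equiv> fcoef L w (\<lambda>y. complex_of_real (f y)) k"

end

theory Submission
  imports Defs "HOL-Real_Asymp.Real_Asymp"
begin

text \<open>
  Each Fourier coefficient in \<open>y\<close> turns the system into linear ordinary differential equations in
  \<open>x\<close>, and the two growth bounds turn these into first order equations whose traces at \<open>x = 0\<close>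
  can be eliminated.

  Fix \<open>t\<close> and \<open>k\<close>, write \<open>\<Lambda>\<close> for the eigenvalue and \<open>X\<^sup>2 = U\<^sup>2 + 4 \<Lambda>\<close>. For every mode the operator is
  \<open>U D - D\<^sup>2 + \<Lambda> = - (D - p) (D - q)\<close> with \<open>p = (U - X) / 2\<close> and \<open>q = (U + X) / 2\<close>. The weight
  \<open>exp (U x / 2)\<close> lies strictly between \<open>exp (p x)\<close> and \<open>exp (q x)\<close>, so the bounds exclude the solution
  \<open>exp (p x)\<close> for \<open>x < 0\<close> and the solution \<open>exp (q x)\<close> for \<open>x > 0\<close>. Excluding one solution is the same
  as having a first order equation for the other one, and this form has no special case at \<open>\<Lambda> = 0\<close>,
  where the source \<open>exp (U x)\<close> is itself a solution of the homogeneous equation. These equations are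
  \<open>subdominant_solution_left\<close> and \<open>subdominant_solution_right\<close>.

  For \<open>u\<close> this gives \<open>u' = q u - (K / q) exp (U x)\<close> with \<open>K = U (U P - Q)\<close>, where \<open>P\<close>, \<open>Q\<close> are the
  coefficients of \<open>(\<phi>\<^sub>y)\<^sup>2\<close> and \<open>\<phi>\<^sub>y\<^sub>y\<close>. In the equation for \<open>v\<close> on the left the unknown \<open>u\<close> then enters
  only through the term \<open>u'\<close>, which is resonant; subtracting a multiple of \<open>x u\<close> from \<open>v\<close> removes it and
  leaves a source \<open>(a + b x) exp (U x)\<close>. So the same argument applies to the difference and yields a
  second relation between traces; the equation on the right yields \<open>v'(0\<^sup>+) = p v(0)\<close>. Together with
  the interface conditions, these relations determine all traces, and what is left is the evolution
  equation (\<open>mode_identity\<close>).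

  The passage to coefficients is differentiation under the integral sign, integration by parts over a
  period and continuity up to \<open>x = 0\<close>. All relations have real coefficients, so it is enough to test
  against the real and imaginary parts of the eigenfunctions, which are periodic solutions of
  \<open>c'' = - \<Lambda> c\<close>.
\<close>

section \<open>Excluding the faster growing solution\<close>

text \<open>By the mean value theorem, \<open>y (x + 1) - y x\<close> is a value of \<open>y'\<close> between \<open>x\<close> and \<open>x + 1\<close>.\<close>

lemma vanishing_function_limit_slope:
  fixes y y' :: "real \<Rightarrow> real"
  assumes deriv: "\<And>x. x < 0 \<Longrightarrow> (y has_real_derivative y' x) (at x)"
    and y: "(y \<longlongrightarrow> 0) at_bot"
    and y': "(y' \<longlongrightarrow> C) at_bot"
  shows "C = 0"
proof -
  have "\<exists>s. x < s \<and> s < x + 1 \<and> y (x + 1) - y x = y' s" if "x < - 1" for x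
  proof -
    have "\<exists>s. s > x \<and> s < x + 1 \<and> y (x + 1) - y x = (x + 1 - x) * y' s"
      using that by (intro MVT2 deriv) auto
    then show ?thesis by auto
  qed
  then obtain \<xi> where xi: "\<And>x. x < - 1 \<Longrightarrow> x < \<xi> x \<and> \<xi> x < x + 1 \<and> y (x + 1) - y x = y' (\<xi> x)"
    by metis
  have ev: "eventually (\<lambda>x. x < (- 1 :: real)) at_bot"
    by (rule eventually_gt_at_bot)
  have "filterlim (\<lambda>x::real. x + 1) at_bot at_bot"
    by real_asymp
  note shift = this
  have "filterlim \<xi> at_bot at_bot"
    by (rule filterlim_at_bot_mono[OF shift]) (use xi in \<open>auto intro!: eventually_mono[OF ev] simp: less_imp_le\<close>)
  then have "((\<lambda>x. y' (\<xi> x)) \<longlongrightarrow> C) at_bot"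
    by (rule filterlim_compose[OF y'])
  moreover have "((\<lambda>x. y (x + 1) - y x) \<longlongrightarrow> 0 - 0) at_bot"
    by (intro tendsto_diff filterlim_compose[OF y shift] y)
  then have "((\<lambda>x. y' (\<xi> x)) \<longlongrightarrow> 0 - 0) at_bot"
    by (rule Lim_transform_eventually) (use xi in \<open>auto intro!: eventually_mono[OF ev]\<close>)
  ultimately show ?thesis
    by (auto intro: tendsto_unique[rotated])
qed

text \<open>
  The equation says that \<open>exp (- p x) (z' - q z - G)\<close> is a constant \<open>C\<close>. Then \<open>exp (- p x) z\<close> tends
  to \<open>0\<close> while its derivative tends to \<open>C\<close>, which forces \<open>C = 0\<close>. Prescribing \<open>G\<close> as a solution of the
  first order equation for the factor \<open>D - p\<close>, instead of the source itself, covers homogeneous and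
  inhomogeneous equations without an integral.
\<close>

lemma subdominant_solution_left:
  fixes z z1 z2 G :: "real \<Rightarrow> real"
  assumes z: "\<And>x. x < 0 \<Longrightarrow> (z has_real_derivative z1 x) (at x)"
    and z1: "\<And>x. x < 0 \<Longrightarrow> (z1 has_real_derivative z2 x) (at x)"
    and G: "\<And>x. x < 0 \<Longrightarrow>
      (G has_real_derivative p * G x + (z2 x - (p + q) * z1 x + p * q * z x)) (at x)"
    and z_decay: "((\<lambda>x. exp (- p * x) * z x) \<longlongrightarrow> 0) at_bot"
    and G_decay: "((\<lambda>x. exp (- p * x) * G x) \<longlongrightarrow> 0) at_bot"
    and x: "x < 0"
  shows "z1 x = q * z x + G x"
proof -
  define h where "h x = exp (- p * x) * (z1 x - q * z x - G x)" for x
  have "(h has_real_derivative 0) (at s)" if "s < 0" for s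
    unfolding h_def
    by (rule derivative_eq_intros z z1 G that refl | simp add: algebra_simps)+
  then have "\<exists>C. \<forall>s\<in>{..<0}. h s = C"
    by (intro has_field_derivative_zero_constant) (auto intro: has_field_derivative_at_within)
  then obtain C where C: "\<And>s. s < 0 \<Longrightarrow> h s = C"
    by auto
  define y where "y s = exp (- p * s) * z s" for s
  define y' where "y' s = exp (- p * s) * (z1 s - p * z s)" for s
  have ev: "eventually (\<lambda>s. s < (0 :: real)) at_bot"
    by (rule eventually_gt_at_bot)
  have "C = 0"
  proof (rule vanishing_function_limit_slope)
    show "(y has_real_derivative y' s) (at s)" if "s < 0" for s
      unfolding y_def y'_def
      by (rule derivative_eq_intros z that refl | simp add: algebra_simps)+
    show "(y \<longlongrightarrow> 0) at_bot"
      using z_decay unfolding y_def .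
    have "((\<lambda>s. C + exp (- p * s) * G s + (q - p) * y s) \<longlongrightarrow> C + 0 + (q - p) * 0) at_bot"
      unfolding y_def by (intro tendsto_intros z_decay G_decay)
    moreover have "C + exp (- p * s) * G s + (q - p) * y s = y' s" if "s < 0" for s
      using C[OF that] by (simp add: y_def y'_def h_def algebra_simps)
    ultimately show "(y' \<longlongrightarrow> C) at_bot"
      by (auto intro: Lim_transform_eventually eventually_mono[OF ev])
  qed
  with C[OF x] show ?thesis
    by (simp add: h_def)
qed

text \<open>The reflection \<open>x \<mapsto> - x\<close> changes the signs of \<open>p\<close> and \<open>q\<close> and reduces this to the left half line.\<close>

lemma subdominant_solution_right:
  fixes z z1 z2 :: "real \<Rightarrow> real"
  assumes z: "\<And>x. x > 0 \<Longrightarrow> (z has_real_derivative z1 x) (at x)"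
    and z1: "\<And>x. x > 0 \<Longrightarrow> (z1 has_real_derivative z2 x) (at x)"
    and ode: "\<And>x. x > 0 \<Longrightarrow> z2 x - (p + q) * z1 x + p * q * z x = 0"
    and decay: "((\<lambda>x. exp (- p * x) * z x) \<longlongrightarrow> 0) at_top"
    and x: "x > 0"
  shows "z1 x = q * z x"
proof -
  have "- z1 (- (- x)) = - q * z (- (- x)) + 0"
  proof (rule subdominant_solution_left[where x = "- x" and p = "- p" and q = "- q"
        and z = "\<lambda>x. z (- x)" and ?z1.0 = "\<lambda>x. - z1 (- x)"
        and ?z2.0 = "\<lambda>x. z2 (- x)" and G = "\<lambda>x. 0"])
    show "((\<lambda>x. z (- x)) has_real_derivative - z1 (- s)) (at s)" if "s < 0" for s
      using DERIV_chain2[where f = z and g = uminus, OF z[of "- s"] DERIV_minus[OF DERIV_ident]] that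
      by simp
    show "((\<lambda>x. - z1 (- x)) has_real_derivative z2 (- s)) (at s)" if "s < 0" for s
      using DERIV_minus[OF DERIV_chain2[where f = z1 and g = uminus, OF z1[of "- s"] DERIV_minus[OF DERIV_ident]]] that
      by simp
    show "((\<lambda>x. 0) has_real_derivative
        (- p) * 0 + (z2 (- s) - ((- p) + (- q)) * (- z1 (- s)) + (- p) * (- q) * z (- s))) (at s)"
      if "s < 0" for s
      using ode[of "- s"] that by (simp add: algebra_simps)
    show "((\<lambda>x. exp (- (- p) * x) * z (- x)) \<longlongrightarrow> 0) at_bot"
      using decay by (simp add: filterlim_at_bot_mirror)
  qed (use x in auto)
  then show ?thesis by simp
qed

section \<open>The identity for a single mode\<close>

text \<open>
  Here \<open>u\<close>, \<open>v\<close> are the coefficients of the unknowns for \<open>x < 0\<close>, and \<open>r\<close> is the coefficient of \<open>v\<close> for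
  \<open>x > 0\<close>; \<open>P\<close>, \<open>Q\<close>, \<open>T\<close> are the coefficients of \<open>(\<phi>\<^sub>y)\<^sup>2\<close>, \<open>\<phi>\<^sub>y\<^sub>y\<close>, \<open>\<phi>\<^sub>t\<close>. The three first order equations
  give the traces \<open>du = - K / q\<close>, \<open>dv = q v0 - A\<close> and \<open>dr = p v0\<close>; the two interface conditions
  eliminate \<open>v0\<close>, and \<open>T\<close> is contained in \<open>A\<close>.
\<close>

lemma mode_identity:
  fixes U \<alpha> \<gamma> V \<Lambda> X P Q T B :: real
    and u u1 u2 v v1 v2 r r1 r2 :: "real \<Rightarrow> real"
  assumes U: "U > 0" and X: "X > 0" "X\<^sup>2 = U\<^sup>2 + 4 * \<Lambda>"
    and V: "V = U * (\<gamma> - \<alpha>)"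
    and u: "\<And>x. x < 0 \<Longrightarrow> (u has_real_derivative u1 x) (at x)"
      "\<And>x. x < 0 \<Longrightarrow> (u1 has_real_derivative u2 x) (at x)"
    and v: "\<And>x. x < 0 \<Longrightarrow> (v has_real_derivative v1 x) (at x)"
      "\<And>x. x < 0 \<Longrightarrow> (v1 has_real_derivative v2 x) (at x)"
    and r: "\<And>x. x > 0 \<Longrightarrow> (r has_real_derivative r1 x) (at x)"
      "\<And>x. x > 0 \<Longrightarrow> (r1 has_real_derivative r2 x) (at x)"
    and eq_u: "\<And>x. x < 0 \<Longrightarrow> U * u1 x - (u2 x - \<Lambda> * u x) = U * exp (U * x) * (U * P - Q)"
    and eq_v: "\<And>x. x < 0 \<Longrightarrow>
      V * u1 x - ((v2 x - \<alpha> * u2 x) - \<Lambda> * (v x - \<alpha> * u x)) + U * v1 x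
        = U * T * exp (U * x) + \<gamma> * U\<^sup>2 * (1 + U * x) * exp (U * x) * P
          - U\<^sup>2 * \<gamma> * x * exp (U * x) * Q"
    and eq_r: "\<And>x. x > 0 \<Longrightarrow> U * r1 x - (r2 x - \<Lambda> * r x) = 0"
    and u_lim: "(u \<longlongrightarrow> 0) (at_left 0)" "(u1 \<longlongrightarrow> du) (at_left 0)"
    and v_lim: "(v \<longlongrightarrow> v0) (at_left 0)" "(v1 \<longlongrightarrow> dv) (at_left 0)"
    and r_lim: "(r \<longlongrightarrow> v0) (at_right 0)" "(r1 \<longlongrightarrow> dr) (at_right 0)"
    and bc: "U * v0 - du = 1 / 2 * U * P" "dr - dv = - \<alpha> * du"
    and u_bound: "\<And>x. x < 0 \<Longrightarrow> \<bar>u x\<bar> \<le> B * exp (U * x / 2)"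
    and v_bound: "\<And>x. x < 0 \<Longrightarrow> \<bar>v x\<bar> \<le> B * exp (U * x / 2)"
    and r_bound: "\<And>x. x > 0 \<Longrightarrow> \<bar>r x\<bar> \<le> B * exp (U * x / 2)"
  shows "X * U * T = (X\<^sup>2 - \<gamma> * U\<^sup>2) * Q
      + 1 / 4 * (X ^ 3 - 3 * U * X\<^sup>2 - 4 * \<gamma> * U\<^sup>2 * X + 4 * \<gamma> * U ^ 3) * P"
proof -
  define p where "p = (U - X) / 2"
  define q where "q = (U + X) / 2"
  define K where "K = U * (U * P - Q)"
  have q: "q > 0" using U X by (simp add: q_def)
  have pq: "p + q = U" "p * q = - \<Lambda>" "q - p = X"
    using X(2) by (auto simp: p_def q_def field_simps power2_eq_square)
  have p': "p = U - q" using pq by simp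
  have X': "X = 2 * q - U"
    using pq by simp
  have split_p: "exp (- p * x) = exp (X * x / 2) * exp (- (U * x / 2))"
    and split_q: "exp (- q * x) = exp (- (X * x / 2)) * exp (- (U * x / 2))" for x
    by (simp_all add: p_def q_def exp_add[symmetric] field_simps)
  have ev: "eventually (\<lambda>x. x < (0 :: real)) at_bot"
    by (rule eventually_gt_at_bot)

  \<comment> \<open>The linear factor \<open>d \<bar>x\<bar>\<close> is there for the correction \<open>x u\<close> of \<open>v\<close> below.\<close>
  have weighted_decay: "((\<lambda>x. exp (- p * x) * f x) \<longlongrightarrow> 0) at_bot"
    if f: "\<And>x. x < 0 \<Longrightarrow> \<bar>f x\<bar> \<le> (c + d * \<bar>x\<bar>) * exp (U * x / 2)" for f c d
  proof (rule Lim_null_comparison)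
    show "eventually (\<lambda>x. norm (exp (- p * x) * f x) \<le> (c + d * \<bar>x\<bar>) * exp (X * x / 2)) at_bot"
      using ev
    proof eventually_elim
      case (elim x)
      have "exp (X * x / 2) * (exp (- (U * x / 2)) * \<bar>f x\<bar>)
          \<le> exp (X * x / 2) * (exp (- (U * x / 2)) * ((c + d * \<bar>x\<bar>) * exp (U * x / 2)))"
        using f[OF elim] by (intro mult_left_mono) auto
      also have "\<dots> = exp (X * x / 2) * (c + d * \<bar>x\<bar>)"
        by (simp add: exp_minus field_simps)
      finally show ?case unfolding split_p by (simp add: abs_mult mult_ac)
    qed
    show "((\<lambda>x. (c + d * \<bar>x\<bar>) * exp (X * x / 2)) \<longlongrightarrow> 0) at_bot"
    proof -
      have "((\<lambda>x. c * exp (X * x / 2)) \<longlongrightarrow> 0) at_bot" using X by real_asymp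
      moreover have "((\<lambda>x. d * (\<bar>x\<bar> * exp (X * x / 2))) \<longlongrightarrow> d * 0) at_bot"
        by (rule tendsto_mult_left) (use X in real_asymp)
      ultimately have "((\<lambda>x. c * exp (X * x / 2) + d * (\<bar>x\<bar> * exp (X * x / 2))) \<longlongrightarrow> 0 + d * 0) at_bot"
        by (rule tendsto_add)
      then show ?thesis by (simp add: algebra_simps)
    qed
  qed
  have source_decay: "((\<lambda>x. exp (- p * x) * (- (c + d * x) * exp (U * x))) \<longlongrightarrow> 0) at_bot" for c d
  proof -
    have "((\<lambda>x. - (c * exp (q * x))) \<longlongrightarrow> 0) at_bot" using q by real_asymp
    moreover have "((\<lambda>x. d * (x * exp (q * x))) \<longlongrightarrow> d * 0) at_bot"
      by (rule tendsto_mult_left) (use q in real_asymp)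
    ultimately have "((\<lambda>x. - (c * exp (q * x)) - d * (x * exp (q * x))) \<longlongrightarrow> 0 - d * 0) at_bot"
      by (rule tendsto_diff)
    moreover have "exp (- p * x) * exp (U * x) = exp (q * x)" for x
      by (simp add: p' exp_add[symmetric] algebra_simps)
    ultimately show ?thesis by (simp add: algebra_simps)
  qed

  have u1: "u1 x = q * u x + - (K / q + 0 * x) * exp (U * x)" if "x < 0" for x
  proof (rule subdominant_solution_left[OF u _ _ _ that])
    show "((\<lambda>x. - (K / q + 0 * x) * exp (U * x)) has_real_derivative
        p * (- (K / q + 0 * s) * exp (U * s)) + (u2 s - (p + q) * u1 s + p * q * u s)) (at s)"
      if "s < 0" for s
    proof -
      have source: "u2 s - (p + q) * u1 s + p * q * u s = - K * exp (U * s)"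
        using eq_u[OF that] unfolding pq K_def by (simp add: algebra_simps)
      show ?thesis
        unfolding source unfolding p' using q by (auto intro!: derivative_eq_intros simp: field_simps)
    qed
    show "((\<lambda>x. exp (- p * x) * u x) \<longlongrightarrow> 0) at_bot"
      by (rule weighted_decay[of _ B 0]) (use u_bound in simp)
    show "((\<lambda>x. exp (- p * x) * (- (K / q + 0 * x) * exp (U * x))) \<longlongrightarrow> 0) at_bot"
      by (rule source_decay)
  qed auto
  have du: "du = - K / q"
  proof (rule tendsto_unique[OF _ u_lim(2)])
    have "((\<lambda>x. q * u x + - (K / q + 0 * x) * exp (U * x)) \<longlongrightarrow> q * 0 + - (K / q + 0 * 0) * exp (U * 0)) (at_left 0)"
      by (intro tendsto_intros u_lim)
    then show "(u1 \<longlongrightarrow> - K / q) (at_left 0)"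
      by (auto elim!: Lim_transform_eventually intro!: eventually_at_leftI[of "-1"] simp: u1)
  qed simp

  \<comment> \<open>With \<open>M\<close> for \<open>U D - D\<^sup>2 + \<Lambda>\<close>: \<open>M (x u) = U u - 2 u' + x K exp (U x)\<close>. The first order equation
      for \<open>u\<close> expresses \<open>U u - 2 u'\<close> as \<open>- (X / q) u'\<close> plus a multiple of \<open>exp (U x)\<close>, and \<open>M v\<close>
      contains \<open>- U \<gamma> u'\<close>. The factor \<open>\<beta>\<close> makes the terms in \<open>u'\<close> cancel in \<open>M (v - \<beta> x u)\<close>.\<close>
  define \<beta> where "\<beta> = U * \<gamma> * q / X"
  define a where "a = U * T + \<gamma> * U\<^sup>2 * P + \<alpha> * K - \<beta> * (U * K / q\<^sup>2)"
  define b where "b = \<gamma> * U * K - \<beta> * K"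
  \<comment> \<open>\<open>(A + (b / q) x) exp (q x)\<close> is the antiderivative of \<open>(a + b x) exp (q x)\<close> that vanishes at
      \<open>- \<infinity>\<close>.\<close>
  define A where "A = a / q - b / q\<^sup>2"
  define z where "z x = v x - \<beta> * (x * u x)" for x
  define z1 where "z1 x = v1 x - \<beta> * (u x + x * u1 x)" for x
  define z2 where "z2 x = v2 x - \<beta> * (2 * u1 x + x * u2 x)" for x
  have z1: "z1 x = q * z x + - (A + b / q * x) * exp (U * x)" if "x < 0" for x
  proof (rule subdominant_solution_left[OF _ _ _ _ _ that])
    show "(z has_real_derivative z1 s) (at s)" if "s < 0" for s
      unfolding z_def z1_def
      by (rule derivative_eq_intros u v that refl | simp add: algebra_simps)+
    show "(z1 has_real_derivative z2 s) (at s)" if "s < 0" for s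
      unfolding z1_def z2_def
      by (rule derivative_eq_intros u v that refl | simp add: algebra_simps)+
    show "((\<lambda>x. - (A + b / q * x) * exp (U * x)) has_real_derivative
        p * (- (A + b / q * s) * exp (U * s)) + (z2 s - (p + q) * z1 s + p * q * z s)) (at s)"
      if s: "s < 0" for s
    proof -
      have u2: "u2 s = U * u1 s + \<Lambda> * u s - K * exp (U * s)"
        using eq_u[OF s] by (simp add: K_def algebra_simps)
      have "z2 s - (p + q) * z1 s + p * q * z s
          = (v2 s - U * v1 s - \<Lambda> * v s) + \<beta> * (U * u s - 2 * u1 s + s * K * exp (U * s))"
        unfolding pq z_def z1_def z2_def u2 by (simp add: algebra_simps)
      moreover have "v2 s - U * v1 s - \<Lambda> * v s = U * \<gamma> * u1 s
          - (U * T + \<gamma> * U\<^sup>2 * P + \<alpha> * K + \<gamma> * U * K * s) * exp (U * s)"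
        using eq_v[OF s] unfolding u2 V K_def by (simp add: algebra_simps power2_eq_square)
      moreover have "\<beta> * (U * u s - 2 * u1 s) = - U * \<gamma> * u1 s + \<beta> * (U * K / q\<^sup>2) * exp (U * s)"
      proof -
        have "u s = (u1 s + K / q * exp (U * s)) / q"
          using u1[OF s] q by (simp add: field_simps)
        then have e1: "U * u s - 2 * u1 s = - (X / q) * u1 s + U * K / q\<^sup>2 * exp (U * s)"
          using q unfolding X' by (simp add: field_simps power2_eq_square)
        have e2: "\<beta> * (- (X / q) * u1 s + m * e) = - (\<beta> * (X / q)) * u1 s + \<beta> * m * e" for m e
          by (simp add: algebra_simps)
        have e3: "\<beta> * (X / q) = U * \<gamma>"
          using X q by (simp add: \<beta>_def)
        show ?thesis unfolding e1 e2 e3 by simp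
      qed
      ultimately have source: "z2 s - (p + q) * z1 s + p * q * z s = - (a + b * s) * exp (U * s)"
        by (simp add: a_def b_def algebra_simps)
      show ?thesis
        unfolding source unfolding p' using q by (auto intro!: derivative_eq_intros simp: A_def field_simps power2_eq_square)
    qed
    show "((\<lambda>x. exp (- p * x) * z x) \<longlongrightarrow> 0) at_bot"
    proof (rule weighted_decay[of _ B "\<bar>\<beta>\<bar> * B"])
      fix x :: real assume x: "x < 0"
      have "\<bar>z x\<bar> \<le> \<bar>v x\<bar> + \<bar>\<beta>\<bar> * \<bar>x\<bar> * \<bar>u x\<bar>"
        unfolding z_def by (metis abs_mult abs_triangle_ineq4 mult.assoc)
      also have "\<dots> \<le> B * exp (U * x / 2) + \<bar>\<beta>\<bar> * \<bar>x\<bar> * (B * exp (U * x / 2))"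
        by (intro add_mono mult_left_mono u_bound v_bound x) auto
      finally show "\<bar>z x\<bar> \<le> (B + \<bar>\<beta>\<bar> * B * \<bar>x\<bar>) * exp (U * x / 2)"
        by (simp add: algebra_simps)
    qed
  qed (rule source_decay)
  have dv: "dv = q * v0 - A"
  proof (rule tendsto_unique)
    have "((\<lambda>x. q * (v x - \<beta> * (x * u x)) + - (A + b / q * x) * exp (U * x)
          + \<beta> * (u x + x * u1 x)) \<longlongrightarrow>
        q * (v0 - \<beta> * (0 * 0)) + - (A + b / q * 0) * exp (U * 0) + \<beta> * (0 + 0 * du)) (at_left 0)"
      by (intro tendsto_intros u_lim v_lim)
    moreover have "q * (v x - \<beta> * (x * u x)) + - (A + b / q * x) * exp (U * x)
          + \<beta> * (u x + x * u1 x) = v1 x" if "x < 0" for x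
      using z1[OF that] by (simp add: z_def z1_def)
    ultimately show "(v1 \<longlongrightarrow> q * v0 - A) (at_left 0)"
      by (auto elim!: Lim_transform_eventually intro!: eventually_at_leftI[of "-1"])
  qed (use v_lim in auto)

  have r1: "r1 x = p * r x" if "x > 0" for x
  proof (rule subdominant_solution_right[OF r _ _ that])
    show "r2 s - (q + p) * r1 s + q * p * r s = 0" if "s > 0" for s
      using eq_r[OF that] pq by (simp add: algebra_simps)
    show "((\<lambda>x. exp (- q * x) * r x) \<longlongrightarrow> 0) at_top"
    proof (rule Lim_null_comparison)
      show "eventually (\<lambda>x. norm (exp (- q * x) * r x) \<le> B * exp (- (X * x / 2))) at_top"
        using eventually_gt_at_top[of 0]
      proof eventually_elim
        case (elim x)
        have "exp (- q * x) * \<bar>r x\<bar> \<le> exp (- q * x) * (B * exp (U * x / 2))"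
          using r_bound[OF elim] by (intro mult_left_mono) auto
        also have "\<dots> = B * exp (- (X * x / 2))"
          unfolding split_q by (simp add: exp_minus field_simps)
        finally show ?case by (simp add: abs_mult)
      qed
      show "((\<lambda>x. B * exp (- (X * x / 2))) \<longlongrightarrow> 0) at_top" using X by real_asymp
    qed
  qed auto
  have dr: "dr = p * v0"
  proof (rule tendsto_unique[OF _ r_lim(2)])
    have "((\<lambda>x. p * r x) \<longlongrightarrow> p * v0) (at_right 0)"
      by (intro tendsto_intros r_lim)
    then show "(r1 \<longlongrightarrow> p * v0) (at_right 0)"
      by (auto elim!: Lim_transform_eventually intro!: eventually_at_rightI[of 0 1] simp: r1)
  qed simp

  have v0: "v0 = P / 2 - K / (U * q)"
    using bc(1) U q unfolding du by (simp add: field_simps)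
  have "A = X * v0 - \<alpha> * du"
    using bc(2) unfolding dr dv pq(3)[symmetric] by (simp add: algebra_simps)
  then have "X * (A * q) = X * ((X * v0 - \<alpha> * du) * q)"
    by simp
  moreover have "X * (A * q) = X * U * T + \<gamma> * U\<^sup>2 * X * P + \<alpha> * K * X - \<gamma> * U * K * ((U + X) / q) + \<gamma> * U * K"
    using X q by (simp add: A_def a_def b_def \<beta>_def field_simps power2_eq_square)
  moreover have "(U + X) / q = 2"
    using q X' by (simp add: field_simps)
  moreover have "X * ((X * v0 - \<alpha> * du) * q) = X\<^sup>2 * q * P / 2 - X\<^sup>2 * K / U + \<alpha> * K * X"
    using U q unfolding du v0 by (simp add: field_simps power2_eq_square)
  ultimately have "X * U * T = X\<^sup>2 * q * P / 2 - X\<^sup>2 * K / U - \<gamma> * U\<^sup>2 * X * P + \<gamma> * U * K"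
    by (simp add: algebra_simps)
  moreover have "X\<^sup>2 * K / U = X\<^sup>2 * (U * P - Q)"
    using U by (simp add: K_def)
  ultimately have "X * U * T = X\<^sup>2 * q * P / 2 - X\<^sup>2 * (U * P - Q) - \<gamma> * U\<^sup>2 * X * P + \<gamma> * U * K"
    by simp
  then show ?thesis
    unfolding K_def q_def by (simp add: field_simps power2_eq_square power3_eq_cube)
qed

section \<open>Coefficients with respect to a real periodic eigenfunction\<close>

definition coef :: "real \<Rightarrow> (real \<Rightarrow> real) \<Rightarrow> (real \<Rightarrow> real) \<Rightarrow> real" where
  "coef L c f = integral {- L/2..L/2} (\<lambda>y. f y * c y)"

definition periodic_eigenfunction :: "real \<Rightarrow> real \<Rightarrow> (real \<Rightarrow> real) \<Rightarrow> bool" where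
  "periodic_eigenfunction L \<Lambda> c \<longleftrightarrow> (\<forall>y. c (y + L) = c y) \<and>
     (\<exists>c'. \<forall>y. (c has_real_derivative c' y) (at y) \<and>
        (c' has_real_derivative - \<Lambda> * c y) (at y))"

lemma periodic_eigenfunction_continuous:
  "periodic_eigenfunction L \<Lambda> c \<Longrightarrow> continuous_on S c"
  unfolding periodic_eigenfunction_def
  by (meson DERIV_continuous continuous_at_imp_continuous_on)

lemma deriv_periodic:
  fixes f f' :: "real \<Rightarrow> real"
  assumes "\<And>y. f (y + L) = f y" "\<And>y. (f has_real_derivative f' y) (at y)"
  shows "f' (y + L) = f' y"
proof -
  have "((\<lambda>s. f (s + L)) has_real_derivative f' (y + L)) (at y)"
    using assms(2)[of "y + L"] by (simp add: DERIV_shift)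
  then show ?thesis
    using assms by (auto intro: DERIV_unique)
qed

lemma coef_integrable:
  fixes f c :: "real \<Rightarrow> real"
  assumes "continuous_on UNIV c" "continuous_on UNIV f"
  shows "(\<lambda>y. f y * c y) integrable_on {a..b}"
  by (intro integrable_continuous_real continuous_intros continuous_on_subset[OF assms(1)]
      continuous_on_subset[OF assms(2)]) auto

lemma coef_add:
  assumes "continuous_on UNIV c" "continuous_on UNIV f" "continuous_on UNIV g"
  shows "coef L c (\<lambda>y. f y + g y) = coef L c f + coef L c g"
  unfolding coef_def distrib_right
  by (rule integral_add[OF coef_integrable[OF assms(1,2)] coef_integrable[OF assms(1,3)]])

lemma coef_cmult: "coef L c (\<lambda>y. a * f y) = a * coef L c f"
  unfolding coef_def mult.assoc by (rule integral_mult_right)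

text \<open>
  A list of pairs of a factor and a function represents a linear combination; the differential
  equations and the interface conditions that combine several traces pass to coefficients as
  instances of this rule.
\<close>

lemma coef_linear_relation:
  fixes fs :: "(real \<times> (real \<Rightarrow> real)) list"
  assumes c: "continuous_on UNIV c"
    and cont: "\<forall>(a, f) \<in> set fs. continuous_on UNIV f"
    and relation: "\<And>y. (\<Sum>(a, f) \<leftarrow> fs. a * f y) = 0"
  shows "(\<Sum>(a, f) \<leftarrow> fs. a * coef L c f) = 0"
proof -
  have "continuous_on UNIV (\<lambda>y. \<Sum>(a, f) \<leftarrow> fs. a * f y) \<and>
      coef L c (\<lambda>y. \<Sum>(a, f) \<leftarrow> fs. a * f y) = (\<Sum>(a, f) \<leftarrow> fs. a * coef L c f)"
    using cont
  proof (induction fs)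
    case Nil
    show ?case by (simp add: coef_def)
  next
    case (Cons p fs)
    obtain a f where p: "p = (a, f)" by fastforce
    have f: "continuous_on UNIV (\<lambda>y. a * f y)"
      and fs: "continuous_on UNIV (\<lambda>y. \<Sum>(a, f) \<leftarrow> fs. a * f y)"
      and IH: "coef L c (\<lambda>y. \<Sum>(a, f) \<leftarrow> fs. a * f y) = (\<Sum>(a, f) \<leftarrow> fs. a * coef L c f)"
      using Cons by (auto simp: p intro: continuous_on_mult_left)
    show ?case
      using continuous_on_add[OF f fs] coef_add[OF c f fs, of L]
      by (simp add: p IH coef_cmult)
  qed
  then show ?thesis
    by (simp add: relation coef_def)
qed

text \<open>
  Since \<open>f'' c - f c'' = (f' c - f c')'\<close> and all four functions are periodic, the integral of the left
  side over a period vanishes.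
\<close>

lemma coef_second_derivative:
  assumes L: "L > 0" and c: "periodic_eigenfunction L \<Lambda> c"
    and per: "\<And>y. f (y + L) = f y"
    and f: "\<And>y. (f has_real_derivative f1 y) (at y)" "\<And>y. (f1 has_real_derivative f2 y) (at y)"
    and cont: "continuous_on UNIV f2"
  shows "coef L c f2 = - \<Lambda> * coef L c f"
proof -
  obtain c' where c': "\<And>y. (c has_real_derivative c' y) (at y)"
      "\<And>y. (c' has_real_derivative - \<Lambda> * c y) (at y)" and c_per: "\<And>y. c (y + L) = c y"
    using c unfolding periodic_eigenfunction_def by blast
  have contc: "continuous_on UNIV c" and contf: "continuous_on UNIV f"
    using c by (auto intro: periodic_eigenfunction_continuous DERIV_continuous_on f)
  define H where "H y = f1 y * c y - f y * c' y" for y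
  have "((\<lambda>y. f2 y * c y + \<Lambda> * (f y * c y)) has_integral H (L/2) - H (- L/2)) {- L/2..L/2}"
  proof (rule fundamental_theorem_of_calculus)
    fix y
    have "(H has_real_derivative f2 y * c y + \<Lambda> * (f y * c y)) (at y)"
      unfolding H_def
      by (rule derivative_eq_intros f c' refl | simp add: algebra_simps)+
    then show "(H has_vector_derivative f2 y * c y + \<Lambda> * (f y * c y)) (at y within {- L/2..L/2})"
      by (auto simp: has_real_derivative_iff_has_vector_derivative intro: has_vector_derivative_at_within)
  qed (use L in simp)
  moreover have "H (- L/2 + L) = H (- L/2)"
    unfolding H_def
    using per[of "- L/2"] c_per[of "- L/2"] deriv_periodic[OF per f(1), of "- L/2"]
      deriv_periodic[OF c_per c'(1), of "- L/2"] by simp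
  ultimately have "((\<lambda>y. f2 y * c y + \<Lambda> * (f y * c y)) has_integral 0) {- L/2..L/2}"
    by simp
  moreover have "((\<lambda>y. f2 y * c y + \<Lambda> * (f y * c y)) has_integral
      coef L c f2 + \<Lambda> * coef L c f) {- L/2..L/2}"
    unfolding coef_def
    by (intro has_integral_add has_integral_mult_right integrable_integral
        coef_integrable contc cont contf)
  ultimately have "0 = coef L c f2 + \<Lambda> * coef L c f"
    by (rule has_integral_unique)
  then show ?thesis by simp
qed

text \<open>
  The derivative is taken within a convex set because the lemma serves both for the variable \<open>x\<close> in
  an open half line and for the time variable, whose interval may contain its end points.
\<close>

lemma coef_has_derivative:
  assumes c: "continuous_on UNIV c"
    and I: "convex I" "x \<in> I"
    and f: "\<And>x y. x \<in> I \<Longrightarrow> ((\<lambda>s. f s y) has_real_derivative f' x y) (at x within I)"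
    and cont: "\<And>x. x \<in> I \<Longrightarrow> continuous_on UNIV (f x)"
    and cont': "continuous_on (I \<times> UNIV) (\<lambda>(x, y). f' x y)"
  shows "((\<lambda>x. coef L c (f x)) has_real_derivative coef L c (f' x)) (at x within I)"
proof -
  have "((\<lambda>x. integral (cbox (- L/2) (L/2)) (\<lambda>y. f x y * c y)) has_real_derivative
      integral (cbox (- L/2) (L/2)) (\<lambda>y. f' x y * c y)) (at x within I)"
  proof (rule leibniz_rule_field_derivative[OF _ _ _ I(2) I(1)])
    show "((\<lambda>x. f x y * c y) has_real_derivative f' s y * c y) (at s within I)" if "s \<in> I" for s y
      by (intro DERIV_cmult_right f that)
    show "(\<lambda>y. f s y * c y) integrable_on cbox (- L/2) (L/2)" if "s \<in> I" for s
      unfolding cbox_interval by (rule coef_integrable[OF c cont[OF that]])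
    have "continuous_on (I \<times> cbox (- L/2) (L/2)) (\<lambda>z. (case z of (x, y) \<Rightarrow> f' x y) * c (snd z))"
      by (intro continuous_intros continuous_on_subset[OF cont'] continuous_on_compose2[OF c]) auto
    then show "continuous_on (I \<times> cbox (- L/2) (L/2)) (\<lambda>(s, y). f' s y * c y)"
      by (simp add: case_prod_unfold)
  qed
  then show ?thesis by (simp add: coef_def)
qed

lemma extension_section:
  fixes g :: "real \<times> real \<Rightarrow> real"
  assumes "continuous_on (closure (I \<times> UNIV)) g" "a \<in> closure I"
  shows "((\<lambda>x. g (x, y)) \<longlongrightarrow> g (a, y)) (at a within I)"
proof -
  have "continuous_on (closure I) (\<lambda>x. g (x, y))"
    by (rule continuous_on_compose2[OF assms(1)]) (auto intro!: continuous_intros simp: closure_Times)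
  then have "((\<lambda>x. g (x, y)) \<longlongrightarrow> g (a, y)) (at a within closure I)"
    using assms(2) by (auto simp: continuous_on_def)
  then show ?thesis
    by (rule tendsto_within_subset) (rule closure_subset)
qed

text \<open>
  The continuous extension is uniformly continuous on compact sets, so the limit can be taken under
  the integral; pointwise, it coincides with the trace.
\<close>

lemma coef_tendsto_boundary:
  assumes c: "continuous_on UNIV c"
    and f: "extends_continuously (I \<times> UNIV) f"
    and a: "a \<in> closure I" "at a within I \<noteq> bot"
  shows "((\<lambda>x. coef L c (f x)) \<longlongrightarrow> coef L c (\<lambda>y. Lim (at a within I) (\<lambda>x. f x y))) (at a within I)"
    and "continuous_on UNIV (\<lambda>y. Lim (at a within I) (\<lambda>x. f x y))"
proof -
  obtain g where g: "continuous_on (closure (I \<times> UNIV)) g"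
    and fg: "\<And>x y. x \<in> I \<Longrightarrow> g (x, y) = f x y"
    using f unfolding extends_continuously_def by force
  have inI: "eventually (\<lambda>x. x \<in> I) (at a within I)"
    by (simp add: eventually_at_filter)
  have Lim: "Lim (at a within I) (\<lambda>x. f x y) = g (a, y)" for y
  proof (rule tendsto_Lim[OF a(2)])
    show "((\<lambda>x. f x y) \<longlongrightarrow> g (a, y)) (at a within I)"
      by (rule Lim_transform_eventually[OF extension_section[OF g a(1)]])
        (auto intro: eventually_mono[OF inI] simp: fg)
  qed
  have "continuous_on (closure I \<times> cbox (- L/2) (L/2)) (\<lambda>z. g z * c (snd z))"
    by (intro continuous_intros continuous_on_subset[OF g] continuous_on_compose2[OF c])
      (auto simp: closure_Times)
  then have "continuous_on (closure I) (\<lambda>x. integral (cbox (- L/2) (L/2)) (\<lambda>y. g (x, y) * c y))"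
    by (intro integral_continuous_on_param) (simp add: case_prod_unfold)
  then have "((\<lambda>x. coef L c (\<lambda>y. g (x, y))) \<longlongrightarrow> coef L c (\<lambda>y. g (a, y))) (at a within closure I)"
    using a(1) by (auto simp: continuous_on_def coef_def)
  then have "((\<lambda>x. coef L c (\<lambda>y. g (x, y))) \<longlongrightarrow> coef L c (\<lambda>y. g (a, y))) (at a within I)"
    by (rule tendsto_within_subset) (rule closure_subset)
  then show "((\<lambda>x. coef L c (f x)) \<longlongrightarrow> coef L c (\<lambda>y. Lim (at a within I) (\<lambda>x. f x y))) (at a within I)"
    unfolding Lim
    by (rule Lim_transform_eventually) (auto intro!: eventually_mono[OF inI] simp: fg)
  show "continuous_on UNIV (\<lambda>y. Lim (at a within I) (\<lambda>x. f x y))"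
    unfolding Lim
    by (rule continuous_on_compose2[OF g]) (use a in \<open>auto intro!: continuous_intros simp: closure_Times\<close>)
qed

lemma coef_bound:
  assumes c: "continuous_on UNIV c" and f: "continuous_on UNIV f"
    and B: "\<And>y. y \<in> {- L/2..L/2} \<Longrightarrow> \<bar>f y\<bar> \<le> B"
  shows "\<bar>coef L c f\<bar> \<le> B * integral {- L/2..L/2} (\<lambda>y. \<bar>c y\<bar>)"
proof -
  have "norm (integral {- L/2..L/2} (\<lambda>y. f y * c y)) \<le> integral {- L/2..L/2} (\<lambda>y. B * \<bar>c y\<bar>)"
  proof (rule integral_norm_bound_integral)
    show "(\<lambda>y. f y * c y) integrable_on {- L/2..L/2}"
      by (rule coef_integrable[OF c f])
    show "(\<lambda>y. B * \<bar>c y\<bar>) integrable_on {- L/2..L/2}"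
      by (intro integrable_continuous_real continuous_intros continuous_on_subset[OF c]) auto
    show "norm (f y * c y) \<le> B * \<bar>c y\<bar>" if "y \<in> {- L/2..L/2}" for y
      using B[OF that] by (simp add: abs_mult mult_right_mono)
  qed
  then show ?thesis by (simp add: coef_def)
qed

section \<open>Functions of class \<open>C\<^sup>2\<close> on a strip\<close>

lemma continuous_on_section:
  assumes "continuous_on (I \<times> UNIV) (\<lambda>(x, y). f x y)" "x \<in> I"
  shows "continuous_on UNIV (f x)"
proof -
  have "continuous_on UNIV (\<lambda>y. (\<lambda>(x, y). f x y) (x, y))"
    by (rule continuous_on_compose2[OF assms(1)]) (use assms(2) in \<open>auto intro!: continuous_intros\<close>)
  then show ?thesis by simp
qed

lemma C2_sections:
  assumes f: "C_diff 2 (I \<times> UNIV) f" and x: "x \<in> I"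
  shows "((\<lambda>s. f s y) has_real_derivative D1 f x y) (at x)"
    "((\<lambda>s. D1 f s y) has_real_derivative D1 (D1 f) x y) (at x)"
    "(f x has_real_derivative D2 f x y) (at y)"
    "(D2 f x has_real_derivative D2 (D2 f) x y) (at y)"
    "continuous_on UNIV (f x)" "continuous_on UNIV (D1 f x)"
    "continuous_on UNIV (D1 (D1 f) x)" "continuous_on UNIV (D2 (D2 f) x)"
proof -
  have "(\<lambda>s. f s y) differentiable (at x)" "(\<lambda>s. D1 f s y) differentiable (at x)"
    "f x differentiable (at y)" "D2 f x differentiable (at y)"
    using f x by (auto simp: numeral_2_eq_2)
  then show "((\<lambda>s. f s y) has_real_derivative D1 f x y) (at x)"
    "((\<lambda>s. D1 f s y) has_real_derivative D1 (D1 f) x y) (at x)"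
    "(f x has_real_derivative D2 f x y) (at y)"
    "(D2 f x has_real_derivative D2 (D2 f) x y) (at y)"
    by (simp_all add: D1_def[of f x] D1_def[of "D1 f"] D2_def[of f x y] D2_def[of "D2 f"]
        DERIV_deriv_iff_real_differentiable)
  show "continuous_on UNIV (f x)" "continuous_on UNIV (D1 f x)"
    "continuous_on UNIV (D1 (D1 f) x)" "continuous_on UNIV (D2 (D2 f) x)"
    by (rule continuous_on_section[OF _ x]; use f in \<open>simp add: numeral_2_eq_2\<close>)+
qed

lemma coef_C2:
  assumes c: "continuous_on UNIV c" and I: "open I" "convex I"
    and f: "C_diff 2 (I \<times> UNIV) f" and x: "x \<in> I"
  shows "((\<lambda>x. coef L c (f x)) has_real_derivative coef L c (D1 f x)) (at x)"
    "((\<lambda>x. coef L c (D1 f x)) has_real_derivative coef L c (D1 (D1 f) x)) (at x)"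
proof -
  note sections = C2_sections[OF f]
  have eq: "at x within I = at x"
    using x I(1) by (rule at_within_open)
  have cont: "continuous_on (I \<times> UNIV) (\<lambda>(x, y). D1 f x y)"
    "continuous_on (I \<times> UNIV) (\<lambda>(x, y). D1 (D1 f) x y)"
    using f by (auto simp: numeral_2_eq_2)
  show "((\<lambda>x. coef L c (f x)) has_real_derivative coef L c (D1 f x)) (at x)"
    unfolding eq[symmetric]
    by (rule coef_has_derivative[OF c I(2) x _ _ cont(1)])
      (rule sections has_field_derivative_at_within | assumption)+
  show "((\<lambda>x. coef L c (D1 f x)) has_real_derivative coef L c (D1 (D1 f) x)) (at x)"
    unfolding eq[symmetric]
    by (rule coef_has_derivative[OF c I(2) x _ _ cont(2)])
      (rule sections has_field_derivative_at_within | assumption)+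
qed

lemma coef_Lap:
  assumes L: "L > 0" and c: "periodic_eigenfunction L \<Lambda> c"
    and f: "C_diff 2 (I \<times> UNIV) f" and x: "x \<in> I"
    and per: "\<And>y. f x (y + L) = f x y"
  shows "coef L c (Lap f x) = coef L c (D1 (D1 f) x) - \<Lambda> * coef L c (f x)"
proof -
  note contc = periodic_eigenfunction_continuous[OF c]
  have "coef L c (D2 (D2 f) x) = - \<Lambda> * coef L c (f x)"
    by (rule coef_second_derivative[OF L c per C2_sections(3,4,8)[OF f x]])
  moreover have "coef L c (Lap f x) = coef L c (D1 (D1 f) x) + coef L c (D2 (D2 f) x)"
    using coef_add[OF contc C2_sections(7,8)[OF f x]] by (simp add: Lap_def[abs_def])
  ultimately show ?thesis by simp
qed

lemma continuous_on_Lap: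
  assumes "C_diff 2 (I \<times> UNIV) f" "x \<in> I"
  shows "continuous_on UNIV (Lap f x)"
proof -
  have "Lap f x = (\<lambda>y. D1 (D1 f) x y + D2 (D2 f) x y)"
    by (simp add: fun_eq_iff Lap_def)
  moreover have "continuous_on UNIV (\<lambda>y. D1 (D1 f) x y + D2 (D2 f) x y)"
    using C2_sections(7,8)[OF assms] by (rule continuous_on_add)
  ultimately show ?thesis by simp
qed

lemma Lap_linear:
  assumes I: "open I" and f: "C_diff 2 (I \<times> UNIV) f" and g: "C_diff 2 (I \<times> UNIV) g"
    and x: "x \<in> I"
  shows "Lap (\<lambda>x y. f x y - a * g x y) x y = Lap f x y - a * Lap g x y"
proof -
  note F = C2_sections[OF f] and G = C2_sections[OF g]
  have 1: "D1 (\<lambda>x y. f x y - a * g x y) s y = D1 f s y - a * D1 g s y" if "s \<in> I" for s y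
    unfolding D1_def[of "\<lambda>x y. f x y - a * g x y"]
    by (rule DERIV_imp_deriv DERIV_diff DERIV_cmult F(1) G(1) that)+
  have 2: "D2 (\<lambda>x y. f x y - a * g x y) x = (\<lambda>y. D2 f x y - a * D2 g x y)"
    unfolding D2_def[of "\<lambda>x y. f x y - a * g x y", abs_def]
    by (rule ext DERIV_imp_deriv DERIV_diff DERIV_cmult F(3) G(3) x)+
  have ev: "eventually (\<lambda>s. s \<in> I) (nhds x)"
    using I x by (rule eventually_nhds_in_open)
  have "D1 (D1 (\<lambda>x y. f x y - a * g x y)) x y = deriv (\<lambda>s. D1 f s y - a * D1 g s y) x"
    unfolding D1_def[of "D1 (\<lambda>x y. f x y - a * g x y)"]
    by (rule deriv_cong_ev) (auto intro: eventually_mono[OF ev] simp: 1)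
  also have "\<dots> = D1 (D1 f) x y - a * D1 (D1 g) x y"
    by (rule DERIV_imp_deriv DERIV_diff DERIV_cmult F(2) G(2) x)+
  finally have "D1 (D1 (\<lambda>x y. f x y - a * g x y)) x y = D1 (D1 f) x y - a * D1 (D1 g) x y" .
  moreover have "D2 (D2 (\<lambda>x y. f x y - a * g x y)) x y = D2 (D2 f) x y - a * D2 (D2 g) x y"
    unfolding D2_def[of "D2 (\<lambda>x y. f x y - a * g x y)"] 2
    by (rule DERIV_imp_deriv DERIV_diff DERIV_cmult F(4) G(4) x)+
  ultimately show ?thesis by (simp add: Lap_def algebra_simps)
qed

section \<open>Complex eigenfunctions and the regularity of the data\<close>

lemma real_eigenfunctions:
  assumes "eigenbasis L w"
  shows "periodic_eigenfunction L (lam L k) (\<lambda>y. Re (w k y))"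
    and "periodic_eigenfunction L (lam L k) (\<lambda>y. Im (w k y))"
proof -
  obtain w' where w': "\<And>y. (w k has_vector_derivative w' y) (at y)"
      "\<And>y. (w' has_vector_derivative (- lam L k *\<^sub>R w k y)) (at y)"
    using assms unfolding eigenbasis_def by blast
  have per: "w k (y + L) = w k y" for y
    using assms unfolding eigenbasis_def by blast
  show "periodic_eigenfunction L (lam L k) (\<lambda>y. Re (w k y))"
    unfolding periodic_eigenfunction_def
    using w' per by (auto intro!: exI[of _ "\<lambda>y. Re (w' y)"]
        simp: has_vector_derivative_complex_iff)
  show "periodic_eigenfunction L (lam L k) (\<lambda>y. Im (w k y))"
    unfolding periodic_eigenfunction_def
    using w' per by (auto intro!: exI[of _ "\<lambda>y. Im (w' y)"]
        simp: has_vector_derivative_complex_iff)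
qed

lemma hat_eq_coef:
  assumes w: "eigenbasis L w" and f: "continuous_on UNIV f"
  shows "hat L w f k = Complex (coef L (\<lambda>y. Re (w k y)) f) (- coef L (\<lambda>y. Im (w k y)) f)"
proof -
  note c = real_eigenfunctions[OF w, of k, THEN periodic_eigenfunction_continuous, of UNIV]
  have "continuous_on UNIV (w k)"
    using continuous_on_Complex[OF c] by simp
  then have cont: "continuous_on {- L/2..L/2} (\<lambda>y. complex_of_real (f y) * cnj (w k y))"
    by (intro continuous_on_mult continuous_on_of_real continuous_on_cnj
        continuous_on_subset[OF f subset_UNIV]) (rule continuous_on_subset[OF _ subset_UNIV])
  have "hat L w f k = integral {- L/2..L/2} (\<lambda>y. complex_of_real (f y) * cnj (w k y))"
    unfolding fcoef_def
    by (rule set_borel_integral_eq_integral(2)[OF borel_integrable_atLeastAtMost'[OF cont]])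
  moreover have "integral {- L/2..L/2} (\<lambda>y. complex_of_real (f y) * cnj (w k y))
      = Complex (coef L (\<lambda>y. Re (w k y)) f) (- coef L (\<lambda>y. Im (w k y)) f)"
    using integral_linear[OF integrable_continuous_real[OF cont] bounded_linear_Re]
      integral_linear[OF integrable_continuous_real[OF cont] bounded_linear_Im]
    by (simp add: complex_eq_iff o_def coef_def)
  ultimately show ?thesis
    by simp
qed

lemma regular_interface_sections:
  assumes reg: "regular_interface J \<phi>" and t: "t \<in> J"
  shows "((\<lambda>s. \<phi> s y) has_real_derivative Dt J \<phi> t y) (at t within J)"
    and "(\<phi> t has_real_derivative D2 \<phi> t y) (at y)"
    and "(D2 \<phi> t has_real_derivative D2 (D2 \<phi>) t y) (at y)"
    and "continuous_on UNIV (\<phi> t)" "continuous_on UNIV (Dt J \<phi> t)"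
      "continuous_on UNIV (D2 \<phi> t)" "continuous_on UNIV (D2 (D2 \<phi>) t)"
proof -
  have d: "(\<lambda>s. \<phi> s y) differentiable (at t within J)" "\<phi> t differentiable (at y)"
    "D2 \<phi> t differentiable (at y)"
    using reg t unfolding regular_interface_def by blast+
  show "((\<lambda>s. \<phi> s y) has_real_derivative Dt J \<phi> t y) (at t within J)"
    using d(1) unfolding Dt_def has_real_derivative_iff_has_vector_derivative
    by (simp add: vector_derivative_works)
  show "(\<phi> t has_real_derivative D2 \<phi> t y) (at y)"
    "(D2 \<phi> t has_real_derivative D2 (D2 \<phi>) t y) (at y)"
    using d(2,3) unfolding D2_def[of \<phi> t y] D2_def[of "D2 \<phi>"]
    by (simp_all add: DERIV_deriv_iff_real_differentiable)
  have c: "continuous_on (J \<times> UNIV) (\<lambda>(t, y). \<phi> t y)"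
    "continuous_on (J \<times> UNIV) (\<lambda>(t, y). Dt J \<phi> t y)"
    "continuous_on (J \<times> UNIV) (\<lambda>(t, y). D2 \<phi> t y)"
    "continuous_on (J \<times> UNIV) (\<lambda>(t, y). D2 (D2 \<phi>) t y)"
    using reg unfolding regular_interface_def by blast+
  show "continuous_on UNIV (\<phi> t)" "continuous_on UNIV (Dt J \<phi> t)"
      "continuous_on UNIV (D2 \<phi> t)" "continuous_on UNIV (D2 (D2 \<phi>) t)"
    by (rule continuous_on_section[OF _ t], rule c)+
qed

lemma coef_weighted_bound:
  assumes c: "continuous_on UNIV c" and cont: "continuous_on UNIV f"
    and B: "\<And>y. y \<in> {- L/2..L/2} \<Longrightarrow> \<bar>exp (- U * x / 2) * f y\<bar> \<le> B"
  shows "\<bar>coef L c f\<bar> \<le> B * integral {- L/2..L/2} (\<lambda>y. \<bar>c y\<bar>) * exp (U * x / 2)"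
proof -
  have "\<bar>coef L c f\<bar> \<le> (B * exp (U * x / 2)) * integral {- L/2..L/2} (\<lambda>y. \<bar>c y\<bar>)"
  proof (rule coef_bound[OF c cont])
    fix y assume y: "y \<in> {- L/2..L/2}"
    have "\<bar>f y\<bar> = \<bar>exp (- U * x / 2) * f y\<bar> * exp (U * x / 2)"
      by (simp add: abs_mult exp_minus field_simps)
    also have "\<dots> \<le> B * exp (U * x / 2)"
      by (intro mult_right_mono B y) simp
    finally show "\<bar>f y\<bar> \<le> B * exp (U * x / 2)" .
  qed
  then show ?thesis by (simp add: mult_ac)
qed

section \<open>The evolution equation of the interface\<close>

theorem proposition3p1:
  fixes U \<alpha> L V \<gamma> :: real
    and J :: "real set"
    and u v :: "real \<Rightarrow> real \<Rightarrow> real \<Rightarrow> real"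
    and \<phi> :: "real \<Rightarrow> real \<Rightarrow> real"
    and w :: "nat \<Rightarrow> real \<Rightarrow> complex"
  assumes U: "0 < U" "U < 1"
    and ell: "L > 0"
    and V: "V = - U * ln U"
    and gamma: "\<gamma> = \<alpha> - ln U"
    and basis: "eigenbasis L w"
    and J: "is_interval J" "\<exists>a\<in>J. \<exists>b\<in>J. a < b"
    and u_regular: "\<And>t. t \<in> J \<Longrightarrow> classical_on ({..<0} \<times> UNIV) (u t)"
    and v_regular: "\<And>t. t \<in> J \<Longrightarrow> classical_on ({..<0} \<times> UNIV) (v t)"
      "\<And>t. t \<in> J \<Longrightarrow> classical_on ({0<..} \<times> UNIV) (v t)"
    and phi_regular: "regular_interface J \<phi>"
    and u_periodic: "\<And>t x y. t \<in> J \<Longrightarrow> u t x (y + L) = u t x y"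
    and v_periodic: "\<And>t x y. t \<in> J \<Longrightarrow> v t x (y + L) = v t x y"
    and phi_periodic: "\<And>t y. t \<in> J \<Longrightarrow> \<phi> t (y + L) = \<phi> t y"
    and u_zero: "\<And>t x y. t \<in> J \<Longrightarrow> x \<ge> 0 \<Longrightarrow> u t x y = 0"
    and v_at_0: "\<And>t y. t \<in> J \<Longrightarrow> v t 0 y = trace_left (v t) y"
    and eq_u: "\<And>t x y. t \<in> J \<Longrightarrow> x < 0 \<Longrightarrow>
      U * D1 (u t) x y - Lap (u t) x y
        = U * exp (U * x) * (U * (D2 \<phi> t y)\<^sup>2 - D2 (D2 \<phi>) t y)"
    and eq_v_left: "\<And>t x y. t \<in> J \<Longrightarrow> x < 0 \<Longrightarrow>
      V * D1 (u t) x y - Lap (\<lambda>x y. v t x y - \<alpha> * u t x y) x y + U * D1 (v t) x y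
        = U * Dt J \<phi> t y * exp (U * x)
          + (\<alpha> - ln U) * U\<^sup>2 * (1 + U * x) * exp (U * x) * (D2 \<phi> t y)\<^sup>2
          - U\<^sup>2 * (\<alpha> - ln U) * x * exp (U * x) * D2 (D2 \<phi>) t y"
    and eq_v_right: "\<And>t x y. t \<in> J \<Longrightarrow> x > 0 \<Longrightarrow>
      U * D1 (v t) x y - Lap (v t) x y = 0"
    and bc_u: "\<And>t y. t \<in> J \<Longrightarrow> trace_left (u t) y = 0"
    and bc_v: "\<And>t y. t \<in> J \<Longrightarrow> jump (v t) y = 0"
    and bc_uv: "\<And>t y. t \<in> J \<Longrightarrow>
      U * v t 0 y - trace_left (D1 (u t)) y = 1 / 2 * U * (D2 \<phi> t y)\<^sup>2"
    and bc_vx: "\<And>t y. t \<in> J \<Longrightarrow> jump (D1 (v t)) y = - \<alpha> * trace_left (D1 (u t)) y"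
    and u_bounded: "\<And>t. t \<in> J \<Longrightarrow>
      bounded ((\<lambda>(x, y). exp (- U * x / 2) * u t x y) ` ({..0} \<times> {- L/2..L/2}))"
    and v_bounded: "\<And>t. t \<in> J \<Longrightarrow>
      bounded ((\<lambda>(x, y). exp (- U * x / 2) * v t x y) ` (UNIV \<times> {- L/2..L/2}))"
  shows "\<forall>t\<in>J. \<forall>k.
      ((\<lambda>s. hat L w (\<phi> s) k) has_vector_derivative hat L w (Dt J \<phi> t) k) (at t within J) \<and>
      complex_of_real (X U L k * U) * hat L w (Dt J \<phi> t) k
        = complex_of_real (- 4 * (lam L k)\<^sup>2 + (\<gamma> - 1) * U\<^sup>2 * lam L k) * hat L w (\<phi> t) k
          + complex_of_real (1 / 4 * (X U L k ^ 3 - 3 * U * (X U L k)\<^sup>2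
                - 4 * \<gamma> * U\<^sup>2 * X U L k + 4 * \<gamma> * U ^ 3))
            * hat L w (\<lambda>y. (D2 \<phi> t y)\<^sup>2) k"
proof (intro ballI allI)
  fix t k assume t: "t \<in> J"
  define \<Lambda> where "\<Lambda> = lam L k"
  define Xk where "Xk = X U L k"
  have lam: "\<Lambda> \<ge> 0" by (simp add: \<Lambda>_def lam_def)
  have X2: "Xk\<^sup>2 = U\<^sup>2 + 4 * \<Lambda>" and X_pos: "Xk > 0"
    using U lam by (auto simp: Xk_def X_def \<Lambda>_def intro: add_pos_nonneg)
  note phi = regular_interface_sections[OF phi_regular t]
  define P where "P y = (D2 \<phi> t y)\<^sup>2" for y
  have contP: "continuous_on UNIV P"
    unfolding P_def by (intro continuous_intros phi)
  have u_classical: "C_diff 2 ({..<0} \<times> UNIV) (u t)" "extends_continuously ({..<0} \<times> UNIV) (u t)"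
      "extends_continuously ({..<0} \<times> UNIV) (D1 (u t))"
    and v_classical: "C_diff 2 ({..<0} \<times> UNIV) (v t)" "extends_continuously ({..<0} \<times> UNIV) (v t)"
      "extends_continuously ({..<0} \<times> UNIV) (D1 (v t))"
    and r_classical: "C_diff 2 ({0<..} \<times> UNIV) (v t)" "extends_continuously ({0<..} \<times> UNIV) (v t)"
      "extends_continuously ({0<..} \<times> UNIV) (D1 (v t))"
    using u_regular[OF t] v_regular[OF t] by (auto simp: classical_on_def)
  have halflines: "open {..<0 :: real}" "open {(0 :: real)<..}" "convex {..<0 :: real}" "convex {(0 :: real)<..}"
    by auto
  note su = C2_sections[OF u_classical(1)] and sv = C2_sections[OF v_classical(1)]
    and sr = C2_sections[OF r_classical(1)]

  have mode: "Xk * U * coef L c (Dt J \<phi> t)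
      = (- 4 * \<Lambda>\<^sup>2 + (\<gamma> - 1) * U\<^sup>2 * \<Lambda>) * coef L c (\<phi> t)
        + 1 / 4 * (Xk ^ 3 - 3 * U * Xk\<^sup>2 - 4 * \<gamma> * U\<^sup>2 * Xk + 4 * \<gamma> * U ^ 3) * coef L c P"
    if c: "periodic_eigenfunction L \<Lambda> c" for c
  proof -
    note contc = periodic_eigenfunction_continuous[OF c, of UNIV]
    note relation = coef_linear_relation[OF contc, where L = L]
    obtain Bu where Bu: "\<And>x y. x \<le> 0 \<Longrightarrow> y \<in> {- L/2..L/2} \<Longrightarrow> \<bar>exp (- U * x / 2) * u t x y\<bar> \<le> Bu"
      using u_bounded[OF t] by (fastforce simp: bounded_iff)
    obtain Bv where Bv: "\<And>x y. y \<in> {- L/2..L/2} \<Longrightarrow> \<bar>exp (- U * x / 2) * v t x y\<bar> \<le> Bv"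
      using v_bounded[OF t] by (fastforce simp: bounded_iff)
    define N where "N = integral {- L/2..L/2} (\<lambda>y. \<bar>c y\<bar>)"
    have N: "N \<ge> 0" unfolding N_def by (rule integral_nonneg)
        (auto intro!: integrable_continuous_real continuous_intros continuous_on_subset[OF contc])
    \<comment> \<open>\<open>mode_identity\<close> asks for one constant in the three bounds.\<close>
    define B where "B = max Bu Bv * N"
    have B: "Bu * N \<le> B" "Bv * N \<le> B"
      unfolding B_def by (auto intro!: mult_right_mono N)
    have trivial: "at_left (0::real) \<noteq> bot" "at_right (0::real) \<noteq> bot"
      by simp_all
    have closure: "(0::real) \<in> closure {..<0}" "(0::real) \<in> closure {0<..}"
      by simp_all
    note lim_u = coef_tendsto_boundary[OF contc u_classical(2) closure(1) trivial(1), folded trace_left_def]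
      and lim_u1 = coef_tendsto_boundary[OF contc u_classical(3) closure(1) trivial(1), folded trace_left_def]
      and lim_v = coef_tendsto_boundary[OF contc v_classical(2) closure(1) trivial(1), folded trace_left_def]
      and lim_v1 = coef_tendsto_boundary[OF contc v_classical(3) closure(1) trivial(1), folded trace_left_def]
      and lim_r = coef_tendsto_boundary[OF contc r_classical(2) closure(2) trivial(2), folded trace_right_def]
      and lim_r1 = coef_tendsto_boundary[OF contc r_classical(3) closure(2) trivial(2), folded trace_right_def]
    have Lap_u: "coef L c (Lap (u t) x) = coef L c (D1 (D1 (u t)) x) - \<Lambda> * coef L c (u t x)"
      if "x \<in> {..<0}" for x
      using that by (rule coef_Lap[where f = "u t", OF ell c u_classical(1)]) (rule u_periodic[OF t])
    have Lap_v: "coef L c (Lap (v t) x) = coef L c (D1 (D1 (v t)) x) - \<Lambda> * coef L c (v t x)"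
      if "x \<in> {..<0}" for x
      using that by (rule coef_Lap[where f = "v t", OF ell c v_classical(1)]) (rule v_periodic[OF t])
    have Lap_r: "coef L c (Lap (v t) x) = coef L c (D1 (D1 (v t)) x) - \<Lambda> * coef L c (v t x)"
      if "x \<in> {0<..}" for x
      using that by (rule coef_Lap[where f = "v t", OF ell c r_classical(1)]) (rule v_periodic[OF t])
    define Q where "Q = coef L c (D2 (D2 \<phi>) t)"
    have Q: "Q = - \<Lambda> * coef L c (\<phi> t)"
      unfolding Q_def
      by (rule coef_second_derivative[OF ell c phi_periodic[OF t] phi(2,3,7)])
    have "Xk * U * coef L c (Dt J \<phi> t) = (Xk\<^sup>2 - \<gamma> * U\<^sup>2) * Q
      + 1 / 4 * (Xk ^ 3 - 3 * U * Xk\<^sup>2 - 4 * \<gamma> * U\<^sup>2 * Xk + 4 * \<gamma> * U ^ 3) * coef L c P"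
    proof (rule mode_identity[OF U(1) X_pos X2])
      show "V = U * (\<gamma> - \<alpha>)"
        by (simp add: V gamma)
      show "((\<lambda>x. coef L c (u t x)) has_real_derivative coef L c (D1 (u t) x)) (at x)"
        "((\<lambda>x. coef L c (D1 (u t) x)) has_real_derivative coef L c (D1 (D1 (u t)) x)) (at x)"
        "((\<lambda>x. coef L c (v t x)) has_real_derivative coef L c (D1 (v t) x)) (at x)"
        "((\<lambda>x. coef L c (D1 (v t) x)) has_real_derivative coef L c (D1 (D1 (v t)) x)) (at x)"
        if "x < 0" for x
        using coef_C2[OF contc halflines(1,3) u_classical(1)]
          coef_C2[OF contc halflines(1,3) v_classical(1)] that by simp_all
      show "((\<lambda>x. coef L c (v t x)) has_real_derivative coef L c (D1 (v t) x)) (at x)"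
        "((\<lambda>x. coef L c (D1 (v t) x)) has_real_derivative coef L c (D1 (D1 (v t)) x)) (at x)"
        if "x > 0" for x
        using coef_C2[OF contc halflines(2,4) r_classical(1)] that by simp_all
      show "U * coef L c (D1 (u t) x) - (coef L c (D1 (D1 (u t)) x) - \<Lambda> * coef L c (u t x))
          = U * exp (U * x) * (U * coef L c P - Q)" if "x < 0" for x
      proof -
        have x: "x \<in> {..<0}" using that by simp
        let ?fs = "[(U, D1 (u t) x), (- 1, Lap (u t) x),
          (- (U * exp (U * x) * U), P), (U * exp (U * x), D2 (D2 \<phi>) t)]"
        have "(\<Sum>(a, f) \<leftarrow> ?fs. a * coef L c f) = 0"
        proof (rule relation)
          show "\<forall>(a, f) \<in> set ?fs. continuous_on UNIV f"
            using su(6)[OF x] continuous_on_Lap[OF u_classical(1) x] contP phi(7) by simp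
          show "(\<Sum>(a, f) \<leftarrow> ?fs. a * f y) = 0" for y
            using eq_u[OF t that, of y] by (simp add: P_def algebra_simps)
        qed
        then show ?thesis
          by (simp add: Q_def Lap_u[OF x] algebra_simps)
      qed
      show "V * coef L c (D1 (u t) x)
          - ((coef L c (D1 (D1 (v t)) x) - \<alpha> * coef L c (D1 (D1 (u t)) x))
            - \<Lambda> * (coef L c (v t x) - \<alpha> * coef L c (u t x)))
          + U * coef L c (D1 (v t) x)
          = U * coef L c (Dt J \<phi> t) * exp (U * x)
            + \<gamma> * U\<^sup>2 * (1 + U * x) * exp (U * x) * coef L c P
            - U\<^sup>2 * \<gamma> * x * exp (U * x) * Q" if "x < 0" for x
      proof -
        have x: "x \<in> {..<0}" using that by simp
        let ?fs = "[(V, D1 (u t) x), (- 1, Lap (v t) x), (\<alpha>, Lap (u t) x), (U, D1 (v t) x),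
          (- (U * exp (U * x)), Dt J \<phi> t), (- (\<gamma> * U\<^sup>2 * (1 + U * x) * exp (U * x)), P),
          (U\<^sup>2 * \<gamma> * x * exp (U * x), D2 (D2 \<phi>) t)]"
        have "(\<Sum>(a, f) \<leftarrow> ?fs. a * coef L c f) = 0"
        proof (rule relation)
          show "\<forall>(a, f) \<in> set ?fs. continuous_on UNIV f"
            using su(6)[OF x] sv(6)[OF x] continuous_on_Lap[OF u_classical(1) x]
              continuous_on_Lap[OF v_classical(1) x] contP phi(5,7) by simp
          show "(\<Sum>(a, f) \<leftarrow> ?fs. a * f y) = 0" for y
            using eq_v_left[OF t that, of y]
            unfolding Lap_linear[OF halflines(1) v_classical(1) u_classical(1) x] gamma[symmetric]
            by (simp add: P_def algebra_simps)
        qed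
        then show ?thesis
          by (simp add: Q_def Lap_u[OF x] Lap_v[OF x] algebra_simps)
      qed
      show "U * coef L c (D1 (v t) x) - (coef L c (D1 (D1 (v t)) x) - \<Lambda> * coef L c (v t x)) = 0"
        if "x > 0" for x
      proof -
        have x: "x \<in> {0<..}" using that by simp
        let ?fs = "[(U, D1 (v t) x), (- 1, Lap (v t) x)]"
        have "(\<Sum>(a, f) \<leftarrow> ?fs. a * coef L c f) = 0"
        proof (rule relation)
          show "\<forall>(a, f) \<in> set ?fs. continuous_on UNIV f"
            using sr(6)[OF x] continuous_on_Lap[OF r_classical(1) x] by simp
          show "(\<Sum>(a, f) \<leftarrow> ?fs. a * f y) = 0" for y
            using eq_v_right[OF t that, of y] by simp
        qed
        then show ?thesis
          by (simp add: Lap_r[OF x])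
      qed
      show "((\<lambda>x. coef L c (u t x)) \<longlongrightarrow> 0) (at_left 0)"
        using lim_u(1) bc_u[OF t] by (simp add: coef_def)
      show "((\<lambda>x. coef L c (D1 (u t) x)) \<longlongrightarrow> coef L c (trace_left (D1 (u t)))) (at_left 0)"
        using lim_u1(1) .
      show "((\<lambda>x. coef L c (v t x)) \<longlongrightarrow> coef L c (v t 0)) (at_left 0)"
        using lim_v(1) v_at_0[OF t] by presburger
      show "((\<lambda>x. coef L c (D1 (v t) x)) \<longlongrightarrow> coef L c (trace_left (D1 (v t)))) (at_left 0)"
        using lim_v1(1) .
      have "trace_right (v t) y = v t 0 y" for y
        using bc_v[OF t, of y] v_at_0[OF t, of y] by (simp add: jump_def)
      then show "((\<lambda>x. coef L c (v t x)) \<longlongrightarrow> coef L c (v t 0)) (at_right 0)"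
        using lim_r(1) by presburger
      show "((\<lambda>x. coef L c (D1 (v t) x)) \<longlongrightarrow> coef L c (trace_right (D1 (v t)))) (at_right 0)"
        using lim_r1(1) .
      have contv0: "continuous_on UNIV (v t 0)"
        using lim_v(2) v_at_0[OF t] by presburger
      show "U * coef L c (v t 0) - coef L c (trace_left (D1 (u t))) = 1 / 2 * U * coef L c P"
      proof -
        let ?fs = "[(U, v t 0), (- 1, trace_left (D1 (u t))), (- (1 / 2 * U), P)]"
        have "(\<Sum>(a, f) \<leftarrow> ?fs. a * coef L c f) = 0"
        proof (rule relation)
          show "\<forall>(a, f) \<in> set ?fs. continuous_on UNIV f"
            using contv0 lim_u1(2) contP by simp
          show "(\<Sum>(a, f) \<leftarrow> ?fs. a * f y) = 0" for y
            using bc_uv[OF t, of y] by (simp add: P_def)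
        qed
        then show ?thesis by simp
      qed
      show "coef L c (trace_right (D1 (v t))) - coef L c (trace_left (D1 (v t)))
          = - \<alpha> * coef L c (trace_left (D1 (u t)))"
      proof -
        let ?fs = "[(1, trace_right (D1 (v t))), (- 1, trace_left (D1 (v t))),
          (\<alpha>, trace_left (D1 (u t)))]"
        have "(\<Sum>(a, f) \<leftarrow> ?fs. a * coef L c f) = 0"
        proof (rule relation)
          show "\<forall>(a, f) \<in> set ?fs. continuous_on UNIV f"
            using lim_r1(2) lim_v1(2) lim_u1(2) by simp
          show "(\<Sum>(a, f) \<leftarrow> ?fs. a * f y) = 0" for y
            using bc_vx[OF t, of y] by (simp add: jump_def)
        qed
        then show ?thesis by simp
      qed
      show "\<bar>coef L c (u t x)\<bar> \<le> B * exp (U * x / 2)" if "x < 0" for x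
      proof -
        have "\<bar>coef L c (u t x)\<bar> \<le> Bu * N * exp (U * x / 2)"
          unfolding N_def by (rule coef_weighted_bound[OF contc su(5)]) (use that Bu[of x] in auto)
        also have "\<dots> \<le> B * exp (U * x / 2)"
          by (rule mult_right_mono[OF B(1)]) simp
        finally show ?thesis .
      qed
      show "\<bar>coef L c (v t x)\<bar> \<le> B * exp (U * x / 2)" if "x < 0" for x
      proof -
        have "\<bar>coef L c (v t x)\<bar> \<le> Bv * N * exp (U * x / 2)"
          unfolding N_def by (rule coef_weighted_bound[OF contc sv(5)]) (use that Bv[of _ x] in auto)
        also have "\<dots> \<le> B * exp (U * x / 2)"
          by (rule mult_right_mono[OF B(2)]) simp
        finally show ?thesis .
      qed
      show "\<bar>coef L c (v t x)\<bar> \<le> B * exp (U * x / 2)" if "x > 0" for x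
      proof -
        have "\<bar>coef L c (v t x)\<bar> \<le> Bv * N * exp (U * x / 2)"
          unfolding N_def by (rule coef_weighted_bound[OF contc sr(5)]) (use that Bv[of _ x] in auto)
        also have "\<dots> \<le> B * exp (U * x / 2)"
          by (rule mult_right_mono[OF B(2)]) simp
        finally show ?thesis .
      qed
    qed
    then show ?thesis
      unfolding Q X2 by (simp add: algebra_simps power2_eq_square)
  qed

  note eig = real_eigenfunctions[OF basis, of k, folded \<Lambda>_def]
  note contw = eig[THEN periodic_eigenfunction_continuous, of UNIV]
  have comb: "complex_of_real a * Complex r1 (- s1)
      = complex_of_real b * Complex r2 (- s2) + complex_of_real d * Complex r3 (- s3)"
    if "a * r1 = b * r2 + d * r3" "a * s1 = b * s2 + d * s3" for a b d r1 s1 r2 s2 r3 s3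
    using that by (simp add: complex_eq_iff)
  note hat_phi = hat_eq_coef[OF basis phi(4), of k]
    and hat_Dt = hat_eq_coef[OF basis phi(5), of k]
    and hat_P = hat_eq_coef[OF basis contP, of k, unfolded P_def]
  have "convex J" using J(1) by (simp add: is_interval_convex)
  then have "((\<lambda>s. coef L c (\<phi> s)) has_real_derivative coef L c (Dt J \<phi> t)) (at t within J)"
    if "continuous_on UNIV c" for c
  proof (rule coef_has_derivative[OF that _ t])
    show "continuous_on (J \<times> UNIV) (\<lambda>(t, y). Dt J \<phi> t y)"
      using phi_regular unfolding regular_interface_def by blast
  qed (use regular_interface_sections[OF phi_regular] in blast)+
  note d = this[OF contw(1)] this[OF contw(2), THEN DERIV_minus]
  have "((\<lambda>s. Complex (coef L (\<lambda>y. Re (w k y)) (\<phi> s)) (- coef L (\<lambda>y. Im (w k y)) (\<phi> s)))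
      has_vector_derivative hat L w (Dt J \<phi> t) k) (at t within J)"
    unfolding hat_Dt has_vector_derivative_complex_iff
    using d by simp
  then have "((\<lambda>s. hat L w (\<phi> s) k) has_vector_derivative hat L w (Dt J \<phi> t) k) (at t within J)"
    by (rule has_vector_derivative_transform[OF t, rotated])
      (simp add: hat_eq_coef[OF basis regular_interface_sections(4)[OF phi_regular]])
  moreover have "complex_of_real (X U L k * U) * hat L w (Dt J \<phi> t) k
        = complex_of_real (- 4 * (lam L k)\<^sup>2 + (\<gamma> - 1) * U\<^sup>2 * lam L k) * hat L w (\<phi> t) k
          + complex_of_real (1 / 4 * (X U L k ^ 3 - 3 * U * (X U L k)\<^sup>2
                - 4 * \<gamma> * U\<^sup>2 * X U L k + 4 * \<gamma> * U ^ 3))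
            * hat L w (\<lambda>y. (D2 \<phi> t y)\<^sup>2) k"
    unfolding hat_phi hat_Dt hat_P
    by (rule comb) (use mode[OF eig(1)] mode[OF eig(2)] in \<open>simp_all only: Xk_def \<Lambda>_def P_def[abs_def]\<close>)
  ultimately show "((\<lambda>s. hat L w (\<phi> s) k) has_vector_derivative hat L w (Dt J \<phi> t) k) (at t within J) \<and>
      complex_of_real (X U L k * U) * hat L w (Dt J \<phi> t) k
        = complex_of_real (- 4 * (lam L k)\<^sup>2 + (\<gamma> - 1) * U\<^sup>2 * lam L k) * hat L w (\<phi> t) k
          + complex_of_real (1 / 4 * (X U L k ^ 3 - 3 * U * (X U L k)\<^sup>2
                - 4 * \<gamma> * U\<^sup>2 * X U L k + 4 * \<gamma> * U ^ 3))
            * hat L w (\<lambda>y. (D2 \<phi> t y)\<^sup>2) k"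
    by (rule conjI)
qed

end
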